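(* Let $C\in W^{(l)}$ and $(\rho,\sigma)\in\mathfrak V$ with $\sigma\le0$. Suppose $v_{\rho,\sigma}(C)>0$ and $\ell_{\rho,\sigma}(C)\neq\zeta\,\ell_{\rho,\sigma}(D^h)$ for all $D\in W^{(l)}$, $\zeta\in K^\times$ and integers $h>1$. If there exist $n,m\in\mathbb{N}$ and $A,B\in W^{(l)}$ such that (1) $\ell_{\rho,\sigma}(A)=\ell_{\rho,\sigma}(C^n)$, (2) $\ell_{\rho,\sigma}(B)=\ell_{\rho,\sigma}(C^m)$, (3) $c:=\gcd(n,m)\notin\{n,m\}$, (4) $\ell_{\rho,\sigma}([A,B])=\lambda\,\ell_{\rho,\sigma}(C^h)$ for some $h\in\mathbb{N}_0$ and $\lambda\in K^\times$, then there exist $D\in W^{(l)}$, $\mu\in K^\times$ and $k,j_0\in\mathbb{N}$ such that $[D,C^k]_{\rho,\sigma}=\mu\,\ell_{\rho,\sigma}(C^{k+j_0})$.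
   Context: $K$ is a field of characteristic zero, $l\in\mathbb{N}$. $W^{(l)}$ is the associative $K$-algebra with $K$-basis $\{X^{i/l}Y^j:i\in\mathbb{Z},j\in\mathbb{N}_0\}$, powers of $X$ multiplying as Laurent monomials and $[Y,X^{\alpha}]=\alpha X^{\alpha-1}$ for $\alpha\in\frac1l\mathbb{Z}$. $L^{(l)}=K[x^{1/l},x^{-1/l},y]$, $\Psi^{(l)}(X^{i/l}Y^j)=x^{i/l}y^j$ ($K$-linear); $\mathrm{Supp}(P)$ = exponents of $\Psi^{(l)}(P)$ with nonzero coefficient. $\mathfrak V=\{(\rho,\sigma)\in\mathbb{Z}^2:\gcd(\rho,\sigma)=1,\rho+\sigma>0\}$. For $P\ne0$: $v_{\rho,\sigma}(P)=\max\{\rho a+\sigma b:(a,b)\in\mathrm{Supp}(P)\}$; $\ell_{\rho,\sigma}(P)\in L^{(l)}$ is the sum of the terms of $\Psi^{(l)}(P)$ of $(\rho,\sigma)$-degree $v_{\rho,\sigma}(P)$. $[P,Q]_{\rho,\sigma}:=0$ if $[P,Q]=0$ or $v_{\rho,\sigma}([P,Q])<v_{\rho,\sigma}(P)+v_{\rho,\sigma}(Q)-(\rho+\sigma)$, and $:=\ell_{\rho,\sigma}([P,Q])$ otherwise. *)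

theory Defs
  imports Complex_Main
begin

text \<open>Elements of W^(l) are represented by their coefficient functions
  P :: int \<times> nat \<Rightarrow> 'a, where P (i,j) is the coefficient of X^(i/l) Y^j;
  the algebra is the set of finitely supported such functions.  Via Psi these
  coefficient functions are also the elements of L^(l) = K[x^(1/l),x^(-1/l),y].\<close>

definition wsupp :: "(int \<times> nat \<Rightarrow> 'a::zero) \<Rightarrow> (int \<times> nat) set" where
  "wsupp P = {e. P e \<noteq> 0}"

definition Walg :: "(int \<times> nat \<Rightarrow> 'a::zero) set" where
  "Walg = {P. finite (wsupp P)}"

text \<open>Product: (X^(a/l) Y^j)(X^(b/l) Y^m)
   = sum_k (j choose k) [b/l]_k X^((a+b-kl)/l) Y^(j-k+m), [.]_k falling factorial.\<close>
definition wmult :: "nat \<Rightarrow> (int \<times> nat \<Rightarrow> 'a::field_char_0) \<Rightarrow> (int \<times> nat \<Rightarrow> 'a) \<Rightarrow> (int \<times> nat \<Rightarrow> 'a)" where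
  "wmult l P Q = (\<lambda>(c,d). \<Sum>(a,j)\<in>wsupp P. \<Sum>(b,m)\<in>wsupp Q. \<Sum>k\<in>{..j}.
      (if a + b - int k * int l = c \<and> j - k + m = d
       then P (a,j) * Q (b,m) * of_nat (j choose k) *
            (\<Prod>i<k. (of_int b / of_nat l - of_nat i))
       else 0))"

definition wone :: "int \<times> nat \<Rightarrow> 'a::field_char_0" where
  "wone = (\<lambda>e. if e = (0,0) then 1 else 0)"

fun wpow :: "nat \<Rightarrow> (int \<times> nat \<Rightarrow> 'a::field_char_0) \<Rightarrow> nat \<Rightarrow> (int \<times> nat \<Rightarrow> 'a)" where
  "wpow l P 0 = wone"
| "wpow l P (Suc n) = wmult l P (wpow l P n)"

definition wcomm :: "nat \<Rightarrow> (int \<times> nat \<Rightarrow> 'a::field_char_0) \<Rightarrow> (int \<times> nat \<Rightarrow> 'a) \<Rightarrow> (int \<times> nat \<Rightarrow> 'a)" where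
  "wcomm l P Q = (\<lambda>e. wmult l P Q e - wmult l Q P e)"

definition wdeg :: "nat \<Rightarrow> int \<Rightarrow> int \<Rightarrow> int \<times> nat \<Rightarrow> rat" where
  "wdeg l \<rho> \<sigma> e = of_int \<rho> * of_int (fst e) / of_nat l + of_int \<sigma> * of_nat (snd e)"

text \<open>v_{rho,sigma}(P) (meaningful for P \<noteq> 0).\<close>
definition vdeg :: "nat \<Rightarrow> int \<Rightarrow> int \<Rightarrow> (int \<times> nat \<Rightarrow> 'a::zero) \<Rightarrow> rat" where
  "vdeg l \<rho> \<sigma> P = Max (wdeg l \<rho> \<sigma> ` wsupp P)"

text \<open>ell_{rho,sigma}(P) as an element of L^(l) (coefficient function); ell(0) = 0.\<close>
definition lterm :: "nat \<Rightarrow> int \<Rightarrow> int \<Rightarrow> (int \<times> nat \<Rightarrow> 'a::zero) \<Rightarrow> (int \<times> nat \<Rightarrow> 'a)" where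
  "lterm l \<rho> \<sigma> P = (\<lambda>e. if wdeg l \<rho> \<sigma> e = vdeg l \<rho> \<sigma> P then P e else 0)"

definition wbracket :: "nat \<Rightarrow> int \<Rightarrow> int \<Rightarrow> (int \<times> nat \<Rightarrow> 'a::field_char_0) \<Rightarrow> (int \<times> nat \<Rightarrow> 'a) \<Rightarrow> (int \<times> nat \<Rightarrow> 'a)" where
  "wbracket l \<rho> \<sigma> P Q =
     (let R = wcomm l P Q in
      if R = (\<lambda>_. 0) \<or> vdeg l \<rho> \<sigma> R < vdeg l \<rho> \<sigma> P + vdeg l \<rho> \<sigma> Q - of_int (\<rho> + \<sigma>)
      then (\<lambda>_. 0) else lterm l \<rho> \<sigma> R)"

definition scal :: "'a::times \<Rightarrow> (int \<times> nat \<Rightarrow> 'a) \<Rightarrow> (int \<times> nat \<Rightarrow> 'a)" where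
  "scal c F = (\<lambda>e. c * F e)"

end

theory Submission
  imports Defs "HOL-Library.Function_Algebras" "HOL-Computational_Algebra.Polynomial_FPS"
begin

text \<open>Since \<open>\<rho> > 0\<close>, homogeneous elements are determined by their degree and their value at \<open>x = 1\<close>,
  a polynomial in \<open>y\<close>; in these terms the leading part of a commutator of elements with leading
  polynomials \<open>f\<close>, \<open>g\<close> of degrees \<open>d\<close>, \<open>d'\<close> is \<open>(d' f' g - d f g') / \<rho>\<close>. If it vanishes, suitable
  powers of \<open>f\<close> and \<open>g\<close> are proportional. Starting from \<open>A\<close> and \<open>B\<close>, one repeatedly replaces \<open>B\<close>
  by \<open>B ^ q - \<eta> A ^ p\<close> with cancelling leading terms. This keeps some power of the leading term of
  \<open>[A, B]\<close> proportional to a power of that of \<open>C\<close>, and brings the degree of \<open>[A, B]\<close> closer to its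
  generic value. Once the latter is reached, \<open>B [A, B] ^ (s - 1)\<close> times a power of \<open>C\<close> is the
  required \<open>D\<close>.\<close>

declare plus_fun_apply [simp del] zero_fun_apply [simp del] minus_apply [simp del]

lemmas fun_apply = plus_fun_apply zero_fun_apply minus_apply

section \<open>Finitely supported coefficient functions and monomials\<close>

definition mono_at :: "int \<times> nat \<Rightarrow> 'a \<Rightarrow> int \<times> nat \<Rightarrow> 'a::zero" where
  "mono_at e c = (\<lambda>x. if x = e then c else 0)"

lemma Walg_finite: "P \<in> Walg \<Longrightarrow> finite (wsupp P)"
  by (simp add: Walg_def)

lemma wsupp_zero [simp]: "wsupp 0 = {}"
  by (simp add: wsupp_def fun_apply)

lemma wsupp_mono_at: "wsupp (mono_at e c) \<subseteq> {e}"
  by (auto simp: wsupp_def mono_at_def)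

lemma wsupp_add: "wsupp (P + Q) \<subseteq> wsupp P \<union> wsupp (Q :: int \<times> nat \<Rightarrow> 'a::ab_group_add)"
  by (auto simp: wsupp_def fun_apply)

lemma wsupp_diff: "wsupp (P - Q) \<subseteq> wsupp P \<union> wsupp (Q :: int \<times> nat \<Rightarrow> 'a::ab_group_add)"
  by (auto simp: wsupp_def fun_apply)

lemma wsupp_scal: "wsupp (scal c P) \<subseteq> wsupp (P :: int \<times> nat \<Rightarrow> 'a::field)"
  by (auto simp: wsupp_def scal_def)

lemma Walg_zero [simp]: "0 \<in> Walg"
  by (simp add: Walg_def)

lemma Walg_mono_at [simp]: "mono_at e c \<in> Walg"
  using finite_subset[OF wsupp_mono_at[of e c]] by (auto simp: Walg_def)

lemma Walg_add [simp]: "P \<in> Walg \<Longrightarrow> Q \<in> Walg \<Longrightarrow> P + Q \<in> Walg"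
  for P :: "int \<times> nat \<Rightarrow> 'a::ab_group_add"
  using finite_subset[OF wsupp_add] by (auto simp: Walg_def)

lemma Walg_diff [simp]: "P \<in> Walg \<Longrightarrow> Q \<in> Walg \<Longrightarrow> P - Q \<in> Walg"
  for P :: "int \<times> nat \<Rightarrow> 'a::ab_group_add"
  using finite_subset[OF wsupp_diff] by (auto simp: Walg_def)

lemma Walg_scal [simp]: "P \<in> Walg \<Longrightarrow> scal c P \<in> Walg"
  for P :: "int \<times> nat \<Rightarrow> 'a::field"
  using finite_subset[OF wsupp_scal] by (auto simp: Walg_def)

lemma Walg_sum: "(\<And>i. i \<in> I \<Longrightarrow> P i \<in> Walg) \<Longrightarrow> sum P I \<in> Walg"
  for P :: "'i \<Rightarrow> int \<times> nat \<Rightarrow> 'a::ab_group_add"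
  by (induction I rule: infinite_finite_induct) auto

lemma mono_at_zero [simp]: "mono_at e 0 = 0"
  by (auto simp: mono_at_def fun_apply)

lemma wone_mono_at: "wone = mono_at (0, 0) 1"
  by (auto simp: wone_def mono_at_def)

lemma Walg_wone [simp]: "wone \<in> Walg"
  by (simp add: wone_mono_at)

lemma sum_fun_apply: "sum P I x = (\<Sum>i\<in>I. P i x)"
  for P :: "'i \<Rightarrow> 'b \<Rightarrow> 'a::comm_monoid_add"
  by (induction I rule: infinite_finite_induct) (auto simp: fun_apply)

text \<open>An element is the finite sum of its monomials. The set \<open>S\<close> lets the same
  rule serve for elements of bounded degree.\<close>

lemma Walg_induct_on [consumes 2, case_names zero mono add]:
  fixes P :: "int \<times> nat \<Rightarrow> 'a::ab_group_add"
  assumes "P \<in> Walg" "wsupp P \<subseteq> S"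
    and "\<phi> 0"
    and "\<And>e c. e \<in> S \<Longrightarrow> \<phi> (mono_at e c)"
    and "\<And>P Q. P \<in> Walg \<Longrightarrow> Q \<in> Walg \<Longrightarrow> wsupp P \<subseteq> S \<Longrightarrow> wsupp Q \<subseteq> S \<Longrightarrow>
          \<phi> P \<Longrightarrow> \<phi> Q \<Longrightarrow> \<phi> (P + Q)"
  shows "\<phi> P"
proof -
  have "wsupp (\<Sum>e\<in>F. mono_at e (P e)) \<subseteq> S \<and> \<phi> (\<Sum>e\<in>F. mono_at e (P e))"
    if "finite F" "F \<subseteq> S" for F
    using that
  proof (induction F)
    case empty
    then show ?case using assms(3) by simp
  next
    case (insert e F)
    have "wsupp (mono_at e (P e)) \<subseteq> S"
      using insert wsupp_mono_at by fastforce
    then show ?case using insert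
      by (auto simp: intro!: assms(4,5) Walg_sum dest: subsetD[OF wsupp_add])
  qed
  moreover have "(\<Sum>e\<in>wsupp P. mono_at e (P e)) = P"
  proof
    fix x
    have "(\<Sum>e\<in>wsupp P. mono_at e (P e) x) = (\<Sum>e\<in>wsupp P. if x = e then P e else 0)"
      by (simp add: mono_at_def)
    also have "\<dots> = P x"
      using Walg_finite[OF assms(1)] by (simp add: wsupp_def fun_apply)
    finally show "(\<Sum>e\<in>wsupp P. mono_at e (P e)) x = P x"
      by (simp add: sum_fun_apply)
  qed
  ultimately show ?thesis
    using assms(1,2) by (metis Walg_finite)
qed

lemmas Walg_induct = Walg_induct_on[where S = UNIV, OF _ subset_UNIV, consumes 1, case_names zero mono add]

section \<open>Bilinearity and closure\<close>

definition falling :: "'a::field_char_0 \<Rightarrow> nat \<Rightarrow> 'a" where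
  "falling x k = (\<Prod>i<k. (x - of_nat i))"

lemma falling_0 [simp]: "falling x 0 = 1"
  and falling_Suc_0 [simp]: "falling x (Suc 0) = x"
  by (simp_all add: falling_def)

lemma falling_gbinomial: "falling x k = fact k * (x gchoose k)"
  by (simp add: falling_def gbinomial_prod_rev atLeast0LessThan)

lemma falling_add: "falling x (m + k) = falling x m * falling (x - of_nat m) k"
  by (induction k) (simp_all add: falling_def algebra_simps)

text \<open>The Vandermonde convolution of generalized binomial coefficients, multiplied by the
  factorial of \<open>j\<close>. It is the identity behind associativity.\<close>

lemma falling_Vandermonde:
  "falling (x + y) j = (\<Sum>k\<le>j. of_nat (j choose k) * falling x k * falling y (j - k))"
proof -
  have "falling (x + y) j = (\<Sum>k\<le>j. fact j * ((x gchoose k) * (y gchoose (j - k))))"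
    by (simp add: falling_gbinomial atLeast0AtMost flip: gbinomial_Vandermonde sum_distrib_left)
  also have "\<dots> = (\<Sum>k\<le>j. of_nat (j choose k) * falling x k * falling y (j - k))"
    by (rule sum.cong) (auto simp: falling_gbinomial binomial_fact)
  finally show ?thesis .
qed

lemma falling_of_nat_eq_0: "j < k \<Longrightarrow> falling (of_nat j) k = 0"
  by (auto simp: falling_def)

lemma falling_of_nat_neq_0: "falling (of_nat j) j \<noteq> 0"
  by (auto simp: falling_def)

definition mono_prod :: "nat \<Rightarrow> int \<times> nat \<Rightarrow> int \<times> nat \<Rightarrow> int \<times> nat \<Rightarrow> 'a::field_char_0" where
  "mono_prod l e e' = (\<Sum>k\<le>snd e. mono_at (fst e + fst e' - int k * int l, snd e - k + snd e')
      (of_nat (snd e choose k) * falling (of_int (fst e') / of_nat l) k))"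

text \<open>Cancellation can make the support of a sum smaller than the union of the supports, so
  bilinearity is read off from sums over finite supersets.\<close>

lemma wmult_superset:
  assumes "finite S" "finite S'" "wsupp P \<subseteq> S" "wsupp Q \<subseteq> S'"
  shows "wmult l P Q x = (\<Sum>e\<in>S. \<Sum>e'\<in>S'. P e * Q e' * mono_prod l e e' x)"
proof -
  have "wmult l P Q x = (\<Sum>e\<in>wsupp P. \<Sum>e'\<in>wsupp Q. P e * Q e' * mono_prod l e e' x)"
    by (cases x)
      (auto simp: wmult_def mono_prod_def sum_fun_apply mono_at_def falling_def sum_distrib_left
        split_beta intro!: sum.cong)
  also have "\<dots> = (\<Sum>e\<in>wsupp P. \<Sum>e'\<in>S'. P e * Q e' * mono_prod l e e' x)"
    by (intro sum.cong refl sum.mono_neutral_left assms) (auto simp: wsupp_def)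
  also have "\<dots> = (\<Sum>e\<in>S. \<Sum>e'\<in>S'. P e * Q e' * mono_prod l e e' x)"
    by (intro sum.mono_neutral_left assms) (auto simp: wsupp_def)
  finally show ?thesis .
qed

lemma wmult_add_left:
  assumes "P \<in> Walg" "P' \<in> Walg" "Q \<in> Walg"
  shows "wmult l (P + P') Q = wmult l P Q + wmult l P' Q"
proof
  fix x
  let ?S = "wsupp P \<union> wsupp P'"
  show "wmult l (P + P') Q x = (wmult l P Q + wmult l P' Q) x"
    using assms
    by (simp add: Walg_finite fun_apply wmult_superset[of ?S "wsupp Q"] wsupp_add sum.distrib ring_distribs)
qed

lemma wmult_add_right:
  assumes "P \<in> Walg" "Q \<in> Walg" "Q' \<in> Walg"
  shows "wmult l P (Q + Q') = wmult l P Q + wmult l P Q'"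
proof
  fix x
  let ?S = "wsupp Q \<union> wsupp Q'"
  show "wmult l P (Q + Q') x = (wmult l P Q + wmult l P Q') x"
    using assms
    by (simp add: Walg_finite fun_apply wmult_superset[of "wsupp P" ?S] wsupp_add sum.distrib ring_distribs)
qed

lemma wmult_zero_left [simp]: "wmult l 0 Q = 0"
  and wmult_zero_right [simp]: "wmult l P 0 = 0"
  by (auto simp: wmult_def fun_apply)

lemma wmult_scal_right:
  assumes "P \<in> Walg" "Q \<in> Walg"
  shows "wmult l P (scal c Q) = scal c (wmult l P Q)"
  using assms
  by (auto simp: scal_def sum_distrib_left mult_ac Walg_finite
      wmult_superset[of "wsupp P" "wsupp Q"] wsupp_scal[unfolded scal_def])

lemma wmult_scal_left:
  assumes "P \<in> Walg" "Q \<in> Walg"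
  shows "wmult l (scal c P) Q = scal c (wmult l P Q)"
  using assms
  by (auto simp: scal_def sum_distrib_left mult_ac Walg_finite
      wmult_superset[of "wsupp P" "wsupp Q"] wsupp_scal[unfolded scal_def])

lemma wmult_mono_at:
  "wmult l (mono_at (a, j) p) (mono_at (b, m) q) =
    (\<Sum>k\<le>j. mono_at (a + b - int k * int l, j - k + m)
      (p * q * of_nat (j choose k) * falling (of_int b / of_nat l) k))"
proof
  fix x
  show "wmult l (mono_at (a, j) p) (mono_at (b, m) q) x =
    (\<Sum>k\<le>j. mono_at (a + b - int k * int l, j - k + m)
      (p * q * of_nat (j choose k) * falling (of_int b / of_nat l) k)) x"
    by (subst wmult_superset[OF _ _ wsupp_mono_at wsupp_mono_at])
      (auto simp: mono_prod_def mono_at_def sum_fun_apply sum_distrib_left mult.assoc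
        intro!: sum.cong)
qed

lemma Walg_wmult [simp]:
  assumes "P \<in> Walg" "Q \<in> Walg"
  shows "wmult l P Q \<in> Walg"
  using assms(1)
proof (induction rule: Walg_induct)
  case (mono e p)
  show ?case using assms(2)
  proof (induction rule: Walg_induct)
    case (mono e' q)
    then show ?case
      by (cases e; cases e') (auto simp: wmult_mono_at intro!: Walg_sum)
  qed (auto simp: wmult_add_right)
qed (auto simp: wmult_add_left assms)

lemma wmult_wone_left [simp]: "P \<in> Walg \<Longrightarrow> wmult l wone P = P"
proof (induction rule: Walg_induct)
  case (mono e c)
  then show ?case by (cases e) (simp add: wone_mono_at wmult_mono_at)
qed (auto simp: wmult_add_right)

lemma wmult_wone_right [simp]: "P \<in> Walg \<Longrightarrow> wmult l P wone = P"
proof (induction rule: Walg_induct)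
  case (mono e c)
  obtain a j where e: "e = (a, j)" by fastforce
  \<comment> \<open>The right factor has X-exponent 0, so only the summand with \<open>k = 0\<close>
    survives.\<close>
  have "falling 0 k = (0::'a)" if "k > 0" for k
    using that falling_of_nat_eq_0[of 0 k] by simp
  then have "wmult l (mono_at (a, j) c) wone =
    (\<Sum>k\<le>j. if k = 0 then mono_at (a, j) c else 0)"
    unfolding wone_mono_at wmult_mono_at by (intro sum.cong) auto
  then show ?case by (simp add: e)
qed (auto simp: wmult_add_left)

lemma Walg_wpow [simp]: "P \<in> Walg \<Longrightarrow> wpow l P n \<in> Walg"
  by (induction n) auto

section \<open>Associativity\<close>

text \<open>The transpose of the action of \<open>W\<close> on Laurent polynomials by \<open>X\<close> and \<open>Y = d/dx\<close>,
  where \<open>f\<close> is the functional with value \<open>f b\<close> on the monomial of exponent \<open>b/l\<close>. Taking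
  the transpose makes all functions \<open>f\<close> admissible; it reverses products.\<close>
definition wact :: "nat \<Rightarrow> (int \<times> nat \<Rightarrow> 'a::field_char_0) \<Rightarrow> (int \<Rightarrow> 'a) \<Rightarrow> int \<Rightarrow> 'a" where
  "wact l P f b = (\<Sum>e\<in>wsupp P. P e * falling (of_int b / of_nat l) (snd e) *
     f (b + fst e - int (snd e) * int l))"

lemma wact_superset:
  assumes "finite S" "wsupp P \<subseteq> S"
  shows "wact l P f b = (\<Sum>e\<in>S. P e * falling (of_int b / of_nat l) (snd e) *
     f (b + fst e - int (snd e) * int l))"
  unfolding wact_def by (intro sum.mono_neutral_left assms) (auto simp: wsupp_def)

lemma wact_add:
  assumes "P \<in> Walg" "Q \<in> Walg"
  shows "wact l (P + Q) f = wact l P f + wact l Q f"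
proof
  fix b
  show "wact l (P + Q) f b = (wact l P f + wact l Q f) b"
    using assms
    by (simp add: Walg_finite fun_apply wact_superset[of "wsupp P \<union> wsupp Q"] wsupp_add ring_distribs sum.distrib)
qed

lemma wact_zero [simp]: "wact l 0 f = 0"
  by (auto simp: wact_def fun_apply)

lemma wact_sum:
  "(\<And>i. i \<in> I \<Longrightarrow> P i \<in> Walg) \<Longrightarrow> wact l (sum P I) f = (\<Sum>i\<in>I. wact l (P i) f)"
  by (induction I rule: infinite_finite_induct) (auto simp: wact_add Walg_sum)

lemma wact_add_fun: "wact l P (f + g) = wact l P f + wact l P g"
  by (auto simp: wact_def fun_apply ring_distribs sum.distrib)

lemma wact_zero_fun [simp]: "wact l P 0 = 0"
  by (auto simp: wact_def fun_apply)

lemma wact_mono_at: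
  "wact l (mono_at (a, j) p) f b = p * falling (of_int b / of_nat l) j * f (b + a - int j * int l)"
  by (subst wact_superset[OF _ wsupp_mono_at]) (auto simp: mono_at_def)

text \<open>Once \<open>falling T m\<close> is split off, Vandermonde collapses the sum over
  \<open>k\<close> to the falling factorial of \<open>B + (T - m)\<close>, the factor with which the
  first monomial acts at the exponent already shifted by the second.\<close>

lemma wact_wmult_mono_at:
  assumes "l \<ge> 1"
  shows "wact l (wmult l (mono_at (a, j) p) (mono_at (b, m) q)) f t =
    wact l (mono_at (b, m) q) (wact l (mono_at (a, j) p) f) t"
proof -
  define T B where "T = (of_int t / of_nat l :: 'a)" and "B = (of_int b / of_nat l :: 'a)"
  have l0: "of_nat l \<noteq> (0::'a)" using assms by simp
  have shift: "of_int (t + b - int m * int l) / of_nat l = B + (T - of_nat m)"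
    using l0 by (simp add: T_def B_def field_simps)
  have fall: "falling T (j - k + m) = falling T m * falling (T - of_nat m) (j - k)" for k
    unfolding add.commute[of _ m] by (rule falling_add)
  \<comment> \<open>The argument of \<open>f\<close> is the same for every \<open>k\<close>.\<close>
  have *: "t + (a + b - int k * int l) - int (j - k + m) * int l
      = t + b - int m * int l + a - int j * int l" if "k \<le> j" for k
    using that by (simp add: of_nat_diff algebra_simps)
  have "wact l (wmult l (mono_at (a, j) p) (mono_at (b, m) q)) f t =
    (\<Sum>k\<le>j. p * q * of_nat (j choose k) * falling B k * falling T (j - k + m) *
      f (t + b - int m * int l + a - int j * int l))"
    unfolding wmult_mono_at wact_sum[OF Walg_mono_at] sum_fun_apply wact_mono_at
    by (intro sum.cong refl) (simp only: * T_def B_def atMost_iff)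
  also have "\<dots> = (\<Sum>k\<le>j. of_nat (j choose k) * falling B k * falling (T - of_nat m) (j - k)) *
      (p * q * falling T m * f (t + b - int m * int l + a - int j * int l))"
    unfolding sum_distrib_right
    by (intro sum.cong refl) (simp only: fall mult_ac)
  also have "\<dots> = q * falling T m * (p * falling (B + (T - of_nat m)) j *
      f (t + b - int m * int l + a - int j * int l))"
    by (simp add: falling_Vandermonde mult_ac)
  finally show ?thesis
    by (simp only: wact_mono_at shift flip: T_def)
qed

lemma wact_wmult:
  assumes "l \<ge> 1" "P \<in> Walg" "Q \<in> Walg"
  shows "wact l (wmult l P Q) f = wact l Q (wact l P f)"
  using assms(2)
proof (induction rule: Walg_induct)
  case (mono e p)
  show ?case using assms(3)
  proof (induction rule: Walg_induct)
    case (mono e' q)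
    show ?case
      by (cases e; cases e') (auto simp: wact_wmult_mono_at[OF assms(1)])
  qed (auto simp: wmult_add_right wact_add)
qed (auto simp: wmult_add_left wact_add wact_add_fun assms)

text \<open>Faithfulness: on the monomial \<open>x^j\<close> the powers \<open>Y^k\<close> with \<open>k > j\<close> vanish, so the
  coefficients are recovered by induction on \<open>j\<close>.\<close>
lemma wact_eq_0_imp:
  assumes l: "l \<ge> 1" and P: "P \<in> Walg" and z: "\<And>f. wact l P f = 0"
  shows "P = 0"
proof -
  have "\<forall>i. P (i, j) = 0" for j
  proof (induction j rule: less_induct)
    case (less j)
    show ?case
    proof
      fix i :: int
      \<comment> \<open>The indicator of \<open>i\<close>, evaluated at \<open>l * j\<close>,
        singles out \<open>(i, j)\<close> among the terms with y-exponent \<open>j\<close>.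
        Inserting \<open>(i, j)\<close> into the support lets the sum collapse to that term in any
        case.\<close>
      let ?f = "\<lambda>x::int. if x = i then 1 else 0 :: 'a"
      let ?S = "insert (i, j) (wsupp P)"
      have l0: "of_nat l \<noteq> (0::'a)" using l by simp
      have "0 = wact l P ?f (int l * int j)" by (simp add: z fun_apply)
      also have "\<dots> = (\<Sum>e\<in>?S. P e * falling (of_nat j) (snd e) *
          ?f (int l * int j + fst e - int (snd e) * int l))"
        using l0 by (subst wact_superset[of ?S]) (auto simp: Walg_finite P)
      also have "\<dots> = (\<Sum>e\<in>?S. if e = (i, j) then P e * falling (of_nat j) j else 0)"
      proof (rule sum.cong[OF refl])
        fix e
        assume "e \<in> ?S"
        obtain i' j' where e: "e = (i', j')" by fastforce
        consider "j' < j" | "j' > j" | "j' = j" by linarith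
        then show "P e * falling (of_nat j) (snd e) *
          ?f (int l * int j + fst e - int (snd e) * int l) =
          (if e = (i, j) then P e * falling (of_nat j) j else 0)"
          by cases (auto simp: e less falling_of_nat_eq_0)
      qed
      also have "\<dots> = P (i, j) * falling (of_nat j) j"
        using P by (simp add: Walg_finite)
      finally show "P (i, j) = 0"
        by (simp add: falling_of_nat_neq_0)
    qed
  qed
  then show ?thesis by (auto simp: fun_apply)
qed

lemma wact_inject:
  assumes "l \<ge> 1" "P \<in> Walg" "Q \<in> Walg" and "\<And>f. wact l P f = wact l Q f"
  shows "P = Q"
proof -
  have "wact l (P - Q) f = 0" for f
    using wact_add[of "P - Q" Q l f] assms by simp
  then have "P - Q = 0"
    using assms by (intro wact_eq_0_imp[OF assms(1)]) auto
  then show ?thesis by simp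
qed

text \<open>Both sides act as the composite of the same three operators, and the action is
  faithful.\<close>

lemma wmult_assoc:
  assumes "l \<ge> 1" "P \<in> Walg" "Q \<in> Walg" "R \<in> Walg"
  shows "wmult l (wmult l P Q) R = wmult l P (wmult l Q R)"
  using assms by (intro wact_inject[OF assms(1)]) (auto simp: wact_wmult)

section \<open>Commutators as derivations\<close>

lemma wmult_diff_left:
  assumes "P \<in> Walg" "P' \<in> Walg" "Q \<in> Walg"
  shows "wmult l (P - P') Q = wmult l P Q - wmult l P' Q"
  using wmult_add_left[of "P - P'" P' Q l] assms by (simp add: algebra_simps)

lemma wmult_diff_right:
  assumes "P \<in> Walg" "Q \<in> Walg" "Q' \<in> Walg"
  shows "wmult l P (Q - Q') = wmult l P Q - wmult l P Q'"
  using wmult_add_right[of P "Q - Q'" Q' l] assms by (simp add: algebra_simps)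

lemma wcomm_eq: "wcomm l P Q = wmult l P Q - wmult l Q P"
  by (auto simp: wcomm_def fun_apply)

lemma Walg_wcomm [simp]: "P \<in> Walg \<Longrightarrow> Q \<in> Walg \<Longrightarrow> wcomm l P Q \<in> Walg"
  by (simp add: wcomm_eq)

lemma wcomm_zero [simp]: "wcomm l 0 P = 0" "wcomm l P 0 = 0"
  by (simp_all add: wcomm_eq)

lemma wcomm_add_left:
  "P \<in> Walg \<Longrightarrow> P' \<in> Walg \<Longrightarrow> Q \<in> Walg \<Longrightarrow> wcomm l (P + P') Q = wcomm l P Q + wcomm l P' Q"
  by (simp add: wcomm_eq wmult_add_left wmult_add_right)

lemma wcomm_add_right:
  "P \<in> Walg \<Longrightarrow> Q \<in> Walg \<Longrightarrow> Q' \<in> Walg \<Longrightarrow> wcomm l P (Q + Q') = wcomm l P Q + wcomm l P Q'"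
  by (simp add: wcomm_eq wmult_add_left wmult_add_right)

lemma scal_diff: "scal c (P - Q) = scal c P - scal c Q"
  for c :: "'a::ring"
  by (auto simp: scal_def fun_apply algebra_simps)

lemma wcomm_diff_scal_right:
  assumes "P \<in> Walg" "Q \<in> Walg" "R \<in> Walg"
  shows "wcomm l P (Q - scal c R) = wcomm l P Q - scal c (wcomm l P R)"
  using assms
  by (simp add: wcomm_eq wmult_diff_left wmult_diff_right wmult_scal_left wmult_scal_right scal_diff)

lemma wcomm_wmult_right:
  assumes "l \<ge> 1" "P \<in> Walg" "Q \<in> Walg" "R \<in> Walg"
  shows "wcomm l P (wmult l Q R) = wmult l (wcomm l P Q) R + wmult l Q (wcomm l P R)"
  using assms by (simp add: wcomm_eq wmult_diff_left wmult_diff_right wmult_assoc)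

lemma wcomm_self_wpow:
  assumes "l \<ge> 1" "P \<in> Walg"
  shows "wcomm l P (wpow l P n) = 0"
proof (induction n)
  case 0
  then show ?case using assms by (simp add: wcomm_eq)
next
  case (Suc n)
  have "wcomm l P P = 0" by (simp add: wcomm_eq)
  then show ?case using assms Suc by (simp add: wcomm_wmult_right)
qed

section \<open>The filtration by degree\<close>

text \<open>A sum of bounds is attained only if each bound is. This decides which terms of a product
  or commutator reach the top degree.\<close>

lemma sum_drop_eq_iff:
  fixes a b d d' x y :: rat
  assumes "a \<le> d" "b \<le> d'" "y \<le> x"
  shows "a + b - x = d + d' - y \<longleftrightarrow> x = y \<and> a = d \<and> b = d'"
  using assms by (intro iffI conjI; linarith)

locale weyl_grading =
  fixes l :: nat and \<rho> \<sigma> :: int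
  assumes l_pos: "l \<ge> 1" and rho_pos: "\<rho> > 0" and sum_pos: "\<rho> + \<sigma> > 0"
begin

abbreviation deg :: "int \<times> nat \<Rightarrow> rat" where "deg \<equiv> wdeg l \<rho> \<sigma>"

text \<open>As 0 belongs to every \<open>filt d\<close>, sums with cancellation need no case
  distinction.\<close>

definition filt :: "rat \<Rightarrow> (int \<times> nat \<Rightarrow> 'a::field_char_0) set" where
  "filt d = {P \<in> Walg. \<forall>e\<in>wsupp P. deg e \<le> d}"

text \<open>The component of degree \<open>d\<close> evaluated at \<open>x = 1\<close>. As \<open>\<rho> > 0\<close>, the \<open>y\<close>-exponent
  determines a monomial of given degree, so nothing is lost.\<close>
definition part :: "rat \<Rightarrow> (int \<times> nat \<Rightarrow> 'a::field_char_0) \<Rightarrow> 'a poly" where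
  "part d P = (\<Sum>e\<in>wsupp P. if deg e = d then monom (P e) (snd e) else 0)"

text \<open>Inverse to \<open>part\<close>: applied to \<open>part d P\<close> it returns the
  component of \<open>P\<close> of degree \<open>d\<close>.\<close>

definition hom :: "rat \<Rightarrow> 'a::field_char_0 poly \<Rightarrow> int \<times> nat \<Rightarrow> 'a" where
  "hom d f = (\<lambda>e. if deg e = d then coeff f (snd e) else 0)"

lemma filt_Walg: "P \<in> filt d \<Longrightarrow> P \<in> Walg"
  by (simp add: filt_def)

lemma filt_zero [simp]: "0 \<in> filt d"
  by (simp add: filt_def)

lemma filt_add: "P \<in> filt d \<Longrightarrow> Q \<in> filt d \<Longrightarrow> P + Q \<in> filt d"
  using wsupp_add[of P Q] by (auto simp: filt_def)

lemma filt_diff: "P \<in> filt d \<Longrightarrow> Q \<in> filt d \<Longrightarrow> P - Q \<in> filt d"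
  using wsupp_diff[of P Q] by (auto simp: filt_def)

lemma filt_scal: "P \<in> filt d \<Longrightarrow> scal c P \<in> filt d"
  using wsupp_scal[of c P] by (auto simp: filt_def)

lemma filt_sum: "(\<And>i. i \<in> I \<Longrightarrow> P i \<in> filt d) \<Longrightarrow> sum P I \<in> filt d"
  by (induction I rule: infinite_finite_induct) (auto simp: filt_add)

lemma filt_mono_at: "deg e \<le> d \<Longrightarrow> mono_at e c \<in> filt d"
  using wsupp_mono_at[of e c] by (auto simp: filt_def)

lemma filt_induct [consumes 1, case_names zero mono add]:
  assumes "P \<in> filt d" "\<phi> 0" "\<And>e c. deg e \<le> d \<Longrightarrow> \<phi> (mono_at e c)"
    and "\<And>P Q. P \<in> filt d \<Longrightarrow> Q \<in> filt d \<Longrightarrow> \<phi> P \<Longrightarrow> \<phi> Q \<Longrightarrow> \<phi> (P + Q)"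
  shows "\<phi> P"
proof -
  have "P \<in> Walg" "wsupp P \<subseteq> {e. deg e \<le> d}"
    using assms(1) by (auto simp: filt_def)
  then show ?thesis
  proof (induction rule: Walg_induct_on)
    case (add P Q)
    then show ?case using assms(4)[of P Q] by (auto simp: filt_def)
  qed (use assms(2,3) in auto)
qed

lemma part_superset:
  assumes "finite S" "wsupp P \<subseteq> S"
  shows "part d P = (\<Sum>e\<in>S. if deg e = d then monom (P e) (snd e) else 0)"
  unfolding part_def by (intro sum.mono_neutral_left assms) (auto simp: wsupp_def)

lemma part_add:
  assumes "P \<in> Walg" "Q \<in> Walg"
  shows "part d (P + Q) = part d P + part d Q"
  using assms
  by (simp add: Walg_finite part_superset[of "wsupp P \<union> wsupp Q"] wsupp_add fun_apply
      add_monom[symmetric] if_distrib flip: sum.distrib cong: if_cong)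

lemma part_zero [simp]: "part d 0 = 0"
  by (simp add: part_def)

lemma part_diff:
  assumes "P \<in> Walg" "Q \<in> Walg"
  shows "part d (P - Q) = part d P - part d Q"
  using part_add[of "P - Q" Q d] assms by (simp add: algebra_simps)

lemma part_scal:
  assumes "P \<in> Walg"
  shows "part d (scal c P) = smult c (part d P)"
proof -
  have "part d (scal c P) = (\<Sum>e\<in>wsupp P. smult c (if deg e = d then monom (P e) (snd e) else 0))"
    using assms
    by (subst part_superset[of "wsupp P"])
      (auto simp: Walg_finite scal_def smult_monom intro!: sum.cong dest: subsetD[OF wsupp_scal[unfolded scal_def]])
  then show ?thesis by (simp add: part_def poly_eq_iff coeff_sum sum_distrib_left)
qed

lemma part_sum: "(\<And>i. i \<in> I \<Longrightarrow> P i \<in> Walg) \<Longrightarrow> part d (sum P I) = (\<Sum>i\<in>I. part d (P i))"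
  by (induction I rule: infinite_finite_induct) (auto simp: part_add Walg_sum)

lemma part_mono_at: "part d (mono_at e c) = (if deg e = d then monom c (snd e) else 0)"
  by (subst part_superset[OF _ wsupp_mono_at]) (auto simp: mono_at_def)

lemma deg_inject: "deg e = deg e' \<Longrightarrow> snd e = snd e' \<Longrightarrow> e = e'"
  using rho_pos l_pos by (auto simp: wdeg_def prod_eq_iff)

lemma coeff_part:
  assumes "P \<in> Walg" "deg e = d"
  shows "coeff (part d P) (snd e) = P e"
proof -
  have "coeff (part d P) (snd e) =
    (\<Sum>e'\<in>insert e (wsupp P). coeff (if deg e' = d then monom (P e') (snd e') else 0) (snd e))"
    using Walg_finite[OF assms(1)]
    by (subst part_superset[of "insert e (wsupp P)"]) (auto simp: coeff_sum)
  also have "\<dots> = (\<Sum>e'\<in>insert e (wsupp P). if e' = e then P e else 0)"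
    using assms by (intro sum.cong refl) (auto simp: prod_eq_iff[symmetric] dest: deg_inject)
  finally have "coeff (part d P) (snd e) = \<dots>" .
  then show ?thesis using assms by (simp add: Walg_finite)
qed

text \<open>Each contraction of a Y with a power of X lowers both exponents by one, which costs
  \<rho> + \<sigma>.\<close>

lemma deg_mult_term:
  assumes "k \<le> j"
  shows "deg (a + b - int k * int l, j - k + m) = deg (a, j) + deg (b, m) - of_nat k * of_int (\<rho> + \<sigma>)"
  using assms l_pos by (simp add: wdeg_def of_nat_diff field_simps)

text \<open>As \<rho> + \<sigma> > 0, only the summand \<open>k = 0\<close> of a product of
  monomials can reach degree \<open>d + d'\<close>, and it is the commutative product.\<close>

lemma filt_part_wmult:
  assumes "P \<in> filt d" "Q \<in> filt d'"
  shows "wmult l P Q \<in> filt (d + d') \<and> part (d + d') (wmult l P Q) = part d P * part d' Q"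
  using assms(1)
proof (induction rule: filt_induct)
  case (mono e p)
  show ?case using assms(2)
  proof (induction rule: filt_induct)
    case (mono e' q)
    obtain a j where e: "e = (a, j)" by fastforce
    obtain b m where e': "e' = (b, m)" by fastforce
    let ?e = "\<lambda>k. (a + b - int k * int l, j - k + m)"
    let ?c = "\<lambda>k. p * q * of_nat (j choose k) * falling (of_int b / of_nat l) k"
    have de: "deg (a, j) \<le> d" "deg (b, m) \<le> d'"
      using \<open>deg e \<le> d\<close> mono by (auto simp: e e')
    have kpos: "of_nat k * of_int (\<rho> + \<sigma>) \<ge> (0::rat)"
      "of_nat k * of_int (\<rho> + \<sigma>) = (0::rat) \<longleftrightarrow> k = 0" for k
      using sum_pos by (simp_all del: of_int_add)
    have le: "deg (?e k) \<le> d + d'" if "k \<le> j" for k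
      using deg_mult_term[OF that] de kpos[of k] by (simp del: of_int_add)
    have eq: "deg (?e k) = d + d' \<longleftrightarrow> k = 0 \<and> deg e = d \<and> deg e' = d'" if "k \<le> j" for k
      unfolding deg_mult_term[OF that] e e'
      using sum_drop_eq_iff[OF de kpos(1)[of k]] kpos(2)[of k] by simp
    have "part (d + d') (wmult l (mono_at e p) (mono_at e' q)) =
      (\<Sum>k\<le>j. if deg (?e k) = d + d' then monom (?c k) (j - k + m) else 0)"
      unfolding e e' wmult_mono_at by (subst part_sum) (simp_all only: Walg_mono_at part_mono_at snd_conv)
    also have "\<dots> = (\<Sum>k\<le>j. if k = 0 then
        (if deg e = d \<and> deg e' = d' then monom (p * q) (j + m) else 0) else 0)"
      by (rule sum.cong[OF refl]) (simp only: eq atMost_iff, auto)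
    also have "\<dots> = part d (mono_at e p) * part d' (mono_at e' q)"
      by (simp add: part_mono_at mult_monom) (simp add: e e')
    finally show ?case
      unfolding e e' wmult_mono_at using le by (auto intro!: filt_sum filt_mono_at)
  qed (auto simp: wmult_add_right part_add filt_add filt_Walg ring_distribs)
qed (use assms in \<open>auto simp: wmult_add_left part_add filt_add filt_Walg ring_distribs\<close>)

text \<open>The Poisson bracket of homogeneous elements of degrees \<open>d\<close> and \<open>d'\<close> at \<open>x = 1\<close>:
  Euler's identity eliminates the derivatives in \<open>x\<close>.\<close>
definition pbracket :: "rat \<Rightarrow> rat \<Rightarrow> 'a::field_char_0 poly \<Rightarrow> 'a poly \<Rightarrow> 'a poly" where
  "pbracket d d' f g = smult (1 / of_int \<rho>)
     (smult (of_rat d') (pderiv f * g) - smult (of_rat d) (f * pderiv g))"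

lemma pbracket_add:
  "pbracket d d' (f + f') g = pbracket d d' f g + pbracket d d' f' g"
  "pbracket d d' f (g + g') = pbracket d d' f g + pbracket d d' f g'"
  by (simp_all add: pbracket_def pderiv_add algebra_simps smult_add_right smult_diff_right)

lemma pbracket_zero [simp]: "pbracket d d' 0 g = 0" "pbracket d d' f 0 = 0"
  by (simp_all add: pbracket_def)

text \<open>The \<sigma>-contributions of the two degrees cancel each other, and \<rho> cancels with
  the normalising factor.\<close>

lemma pbracket_monom:
  fixes p q :: "'a::field_char_0"
  shows
  "pbracket (deg (a, j)) (deg (b, m)) (monom p j) (monom q m) =
     monom (p * q * (of_nat j * of_int b - of_nat m * of_int a) / of_nat l) (j + m - 1)"
proof -
  have l0: "of_nat l \<noteq> (0::'a)" and r0: "of_int \<rho> \<noteq> (0::'a)"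
    using l_pos rho_pos by auto
  \<comment> \<open>For \<open>j = 0\<close> both sides vanish, so the truncated exponent is
    harmless; likewise for \<open>m = 0\<close> in the next equation.\<close>
  have A: "smult x (pderiv (monom p j) * monom q m) = monom (x * of_nat j * p * q) (j + m - 1)" for x
    by (cases j) (simp_all add: pderiv_monom mult_monom smult_monom mult_ac add.commute)
  have B: "smult x (monom p j * pderiv (monom q m)) = monom (x * of_nat m * p * q) (j + m - 1)" for x
    by (cases m) (simp_all add: pderiv_monom mult_monom smult_monom mult_ac add.commute)
  have C: "of_rat (deg (i, k)) = of_int \<rho> * of_int i / of_nat l + of_int \<sigma> * (of_nat k :: 'a)" for i k
    by (simp add: wdeg_def of_rat_add of_rat_mult of_rat_divide)
  show ?thesis
    unfolding pbracket_def A B C diff_monom smult_monom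
    by (rule arg_cong[of _ _ "\<lambda>x. monom x _"]) (use l0 r0 in \<open>simp add: field_simps\<close>)
qed

text \<open>In a commutator of monomials the summands \<open>k = 0\<close> of the two products
  cancel, and those with \<open>k \<ge> 2\<close> lie below degree \<open>s\<close>. The summands
  \<open>k = 1\<close> remain and combine to the Poisson bracket.\<close>

lemma filt_part_wcomm:
  fixes P Q :: "int \<times> nat \<Rightarrow> 'a::field_char_0"
  assumes "P \<in> filt d" "Q \<in> filt d'"
  defines "s \<equiv> d + d' - of_int (\<rho> + \<sigma>)"
  shows "wcomm l P Q \<in> filt s \<and> part s (wcomm l P Q) = pbracket d d' (part d P) (part d' Q)"
  using assms(1)
proof (induction rule: filt_induct)
  case (mono e p)
  show ?case using assms(2)
  proof (induction rule: filt_induct)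
    case (mono e' q)
    obtain a j where e: "e = (a, j)" by fastforce
    obtain b m where e': "e' = (b, m)" by fastforce
    define M where "M = (\<lambda>a j b m k. mono_at (a + b - int k * int l, j - k + m)
      (p * q * of_nat (j choose k) * falling (of_int b / of_nat l) k) :: int \<times> nat \<Rightarrow> 'a)"
    have de: "deg (a, j) \<le> d" "deg (b, m) \<le> d'"
      using \<open>deg e \<le> d\<close> mono by (auto simp: e e')
    have split: "(\<Sum>k\<le>j. M a j b m k) = mono_at (a + b, j + m) (p * q) + (\<Sum>k\<in>{1..j}. M a j b m k)"
      for a b j m
    proof -
      have "{..j} = insert 0 {1..j}" by auto
      then show ?thesis by (simp add: M_def)
    qed
    have W: "M a j b m k \<in> Walg" for a j b m k
      by (simp add: M_def)
    have "wmult l (mono_at e p) (mono_at e' q) = (\<Sum>k\<le>j. M a j b m k)"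
      by (simp add: e e' wmult_mono_at M_def)
    moreover have "wmult l (mono_at e' q) (mono_at e p) = (\<Sum>k\<le>m. M b m a j k)"
      by (simp add: e e' wmult_mono_at M_def mult_ac)
    ultimately have comm: "wcomm l (mono_at e p) (mono_at e' q) =
        (\<Sum>k\<in>{1..j}. M a j b m k) - (\<Sum>k\<in>{1..m}. M b m a j k)"
      by (simp add: wcomm_eq split add.commute)
    \<comment> \<open>Stated for separate bounds \<open>dd\<close>, \<open>dd'\<close> because it is
      applied to both orders of the product.\<close>
    have part: "(\<Sum>k\<in>{1..j}. M a j b m k) \<in> filt s \<and>
      part s (\<Sum>k\<in>{1..j}. M a j b m k) =
        (if deg (a, j) = dd \<and> deg (b, m) = dd'
         then monom (p * q * of_nat j * of_int b / of_nat l) (j + m - 1) else 0)"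
      if "deg (a, j) \<le> dd" "deg (b, m) \<le> dd'" "dd + dd' = d + d'" for a j b m dd dd'
    proof
      have k1: "of_nat k * of_int (\<rho> + \<sigma>) \<ge> (of_int (\<rho> + \<sigma>) :: rat)"
        "of_nat k * of_int (\<rho> + \<sigma>) = (of_int (\<rho> + \<sigma>) :: rat) \<longleftrightarrow> k = 1"
        if "k \<ge> 1" for k
        using that sum_pos by (simp_all del: of_int_add)
      show "(\<Sum>k\<in>{1..j}. M a j b m k) \<in> filt s"
        unfolding M_def
      proof (intro filt_sum filt_mono_at)
        fix k
        assume "k \<in> {1..j}"
        then show "deg (a + b - int k * int l, j - k + m) \<le> s"
          using deg_mult_term[of k j a b m] k1[of k] that by (auto simp: s_def simp del: of_int_add)
      qed
      have eq: "deg (a + b - int k * int l, j - k + m) = s \<longleftrightarrow>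
        k = 1 \<and> deg (a, j) = dd \<and> deg (b, m) = dd'" if "1 \<le> k" "k \<le> j" for k
        unfolding deg_mult_term[OF that(2)] s_def
        using sum_drop_eq_iff[OF \<open>deg (a, j) \<le> dd\<close> \<open>deg (b, m) \<le> dd'\<close> k1(1)[OF that(1)]]
          k1(2)[OF that(1)] \<open>dd + dd' = d + d'\<close> by simp
      have "part s (\<Sum>k\<in>{1..j}. M a j b m k) = (\<Sum>k\<in>{1..j}. if k = 1 then
         (if deg (a, j) = dd \<and> deg (b, m) = dd'
         then monom (p * q * of_nat j * of_int b / of_nat l) (j + m - 1) else 0) else 0)"
        unfolding part_sum[OF W]
        by (rule sum.cong[OF refl]) (simp only: M_def part_mono_at eq atLeastAtMost_iff snd_conv, auto)
      also have "\<dots> = (if deg (a, j) = dd \<and> deg (b, m) = dd'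
         then monom (p * q * of_nat j * of_int b / of_nat l) (j + m - 1) else 0)"
        by (cases j) auto
      finally show "part s (\<Sum>k\<in>{1..j}. M a j b m k) = \<dots>" .
    qed
    note p1 = part[OF de refl] and p2 = part[OF de(2,1) add.commute]
    have "part s (wcomm l (mono_at e p) (mono_at e' q)) =
      (if deg e = d \<and> deg e' = d'
       then monom (p * q * (of_nat j * of_int b - of_nat m * of_int a) / of_nat l) (j + m - 1) else 0)"
      unfolding comm using p1 p2
      by (simp add: part_diff Walg_sum W)
        (auto simp: e e' diff_monom add.commute algebra_simps diff_divide_distrib)
    also have "\<dots> = pbracket d d' (part d (mono_at e p)) (part d' (mono_at e' q))"
      using pbracket_monom[of a j b m p q] by (auto simp: part_mono_at e e')
    finally show ?case
      using p1 p2 unfolding comm by (auto intro: filt_diff)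
  qed (auto simp: wcomm_add_right part_add filt_add filt_Walg pbracket_add)
qed (use assms in \<open>auto simp: wcomm_add_left part_add filt_add filt_Walg pbracket_add\<close>)

end

section \<open>Poisson commuting leading terms\<close>

text \<open>In the top position the two sides have the product of the leading coefficients times the
  degree of \<open>F\<close> and of \<open>G\<close>, respectively; in characteristic 0 the degrees
  agree. Constants are separate because their derivative is 0.\<close>

lemma degree_eq_of_wronskian_0:
  fixes F G :: "'a::field_char_0 poly"
  assumes "pderiv F * G = F * pderiv G" "F \<noteq> 0" "G \<noteq> 0"
  shows "degree F = degree G"
proof (cases "degree F = 0 \<or> degree G = 0")
  case True
  then have "pderiv F = 0 \<and> pderiv G = 0"
    using assms by (auto simp flip: pderiv_eq_0_iff)
  then show ?thesis by (simp add: pderiv_eq_0_iff)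
next
  case False
  have "coeff (pderiv F * G) (degree F - 1 + degree G) = of_nat (degree F) * lead_coeff F * lead_coeff G"
    using coeff_mult_degree_sum[of "pderiv F" G] False by (simp add: degree_pderiv coeff_pderiv)
  moreover have "coeff (F * pderiv G) (degree F + (degree G - 1)) =
      of_nat (degree G) * lead_coeff F * lead_coeff G"
    using coeff_mult_degree_sum[of F "pderiv G"] False by (simp add: degree_pderiv coeff_pderiv)
  moreover have "degree F - 1 + degree G = degree F + (degree G - 1)"
    using False by simp
  ultimately have "of_nat (degree F) * lead_coeff F * lead_coeff G = of_nat (degree G) * lead_coeff F * lead_coeff G"
    using assms(1) by metis
  then show ?thesis using assms by simp
qed

text \<open>Subtracting the multiple of \<open>G\<close> that cancels the leading term leaves some
  \<open>H\<close> with the same Wronskian relation. It cannot have the degree of \<open>G\<close>,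
  hence is 0.\<close>

lemma proportional_of_wronskian_0:
  fixes F G :: "'a::field_char_0 poly"
  assumes "pderiv F * G = F * pderiv G" "F \<noteq> 0" "G \<noteq> 0"
  obtains c where "c \<noteq> 0" "F = smult c G"
proof -
  define c where "c = lead_coeff F / lead_coeff G"
  define H where "H = F - smult c G"
  have "pderiv H * G = H * pderiv G"
    using assms(1) by (simp add: H_def pderiv_diff pderiv_smult algebra_simps)
  moreover have "coeff H (degree G) = 0"
    using degree_eq_of_wronskian_0[OF assms] assms by (simp add: H_def c_def)
  ultimately have "H = 0"
    using degree_eq_of_wronskian_0[of H G] assms(3) leading_coeff_0_iff by metis
  then have "F = smult c G" by (simp add: H_def)
  moreover have "c \<noteq> 0" using assms by (simp add: c_def)
  ultimately show ?thesis using that by blast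
qed

lemma nonneg_rat_eq_ratio:
  fixes x :: rat
  assumes "x \<ge> 0"
  obtains p q :: nat where "q \<ge> 1" "of_nat q * x = of_nat p"
proof -
  obtain a b where ab: "quotient_of x = (a, b)" by fastforce
  have b: "b > 0" and x: "x = of_int a / of_int b"
    using quotient_of_denom_pos[OF ab] quotient_of_div[OF ab] by auto
  have "a \<ge> 0" using assms b by (simp add: x zero_le_divide_iff)
  then have "of_nat (nat b) * x = of_nat (nat a)"
    using b by (simp add: x)
  then show ?thesis using that[of "nat b" "nat a"] b by simp
qed

context weyl_grading
begin

section \<open>Powers in the Poisson bracket\<close>

lemma pbracket_mult_right:
  "pbracket w (d + d') a (f * g) = pbracket w d a f * g + f * pbracket w d' a g"
  by (simp add: pbracket_def pderiv_mult of_rat_add algebra_simps smult_add_right smult_diff_right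
      smult_add_left)

lemma pbracket_swap: "pbracket d d' f g = - pbracket d' d g f"
  by (simp add: pbracket_def algebra_simps smult_diff_right)

lemma pbracket_power_Suc:
  "pbracket w (of_nat (Suc n) * d) a (f ^ Suc n) = smult (of_nat (Suc n)) (f ^ n * pbracket w d a f)"
proof (induction n)
  case 0
  then show ?case by simp
next
  case (Suc n)
  have "pbracket w (of_nat (Suc (Suc n)) * d) a (f ^ Suc (Suc n)) =
    pbracket w (d + of_nat (Suc n) * d) a (f * f ^ Suc n)"
    by (simp add: algebra_simps)
  also have "\<dots> = smult (of_nat (Suc (Suc n))) (f ^ Suc n * pbracket w d a f)"
    unfolding pbracket_mult_right Suc of_nat_Suc[of "Suc n"] smult_add_left
    by (simp add: mult_ac del: of_nat_Suc)
  finally show ?case .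
qed

lemma pbracket_power_eq_0:
  assumes "pbracket w d a f = 0"
  shows "pbracket w (of_nat n * d) a (f ^ n) = 0"
  using assms by (cases n) (simp_all only: pbracket_power_Suc, simp_all add: pbracket_def)

lemma pbracket_self: "pbracket w w a a = 0"
  by (simp add: pbracket_def mult.commute)

text \<open>\<open>a ^ h\<close> Poisson commutes with \<open>a\<close>, hence so does
  \<open>g ^ s\<close>. The bracket of \<open>a\<close> with \<open>g ^ s\<close> is
  \<open>s * g ^ (s - 1)\<close> times that with \<open>g\<close>, and this factor is nonzero in
  characteristic 0.\<close>

lemma pbracket_eq_0_of_power:
  assumes "g ^ s = smult \<zeta> (a ^ h)" "of_nat s * z = of_nat h * w" "s \<ge> 1" "g \<noteq> 0"
  shows "pbracket w z a g = 0"
proof -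
  obtain n where n: "s = Suc n" using assms(3) by (cases s) auto
  have "pbracket w (of_nat s * z) a (g ^ s) = smult \<zeta> (pbracket w (of_nat h * w) a (a ^ h))"
    unfolding assms(1,2) by (simp add: pbracket_def pderiv_smult algebra_simps smult_diff_right)
  also have "\<dots> = 0" by (simp add: pbracket_power_eq_0 pbracket_self)
  finally show ?thesis
    using assms(4) unfolding n pbracket_power_Suc by (simp del: of_nat_Suc)
qed

text \<open>\<open>b ^ q\<close> and \<open>a ^ p\<close> have the same weight \<open>t\<close>, so
  both solve the linear equation w a F' = t a' F. Hence their Wronskian vanishes.\<close>

lemma power_proportional_of_pbracket_0:
  assumes "pbracket w u a b = 0" "a \<noteq> 0" "b \<noteq> 0" "w \<noteq> 0" "of_nat q * u = of_nat p * w"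
  obtains \<eta> where "\<eta> \<noteq> 0" "b ^ q = smult \<eta> (a ^ p)"
proof -
  define t where "t = of_nat p * w"
  have r0: "of_int \<rho> \<noteq> (0::'a)" using rho_pos by simp
  have eq: "smult (of_rat t) (pderiv a * F) = smult (of_rat w) (a * pderiv F)"
    if "pbracket w t a F = 0" for F
    using that r0 by (simp add: pbracket_def)
  have b: "smult (of_rat t) (pderiv a * b ^ q) = smult (of_rat w) (a * pderiv (b ^ q))"
    using pbracket_power_eq_0[OF assms(1), of q] by (intro eq) (simp add: assms(5) t_def)
  have a: "smult (of_rat t) (pderiv a * a ^ p) = smult (of_rat w) (a * pderiv (a ^ p))"
    using pbracket_power_eq_0[OF pbracket_self[of w a], of p] by (intro eq) (simp add: t_def)
  have "smult (of_rat w) (a * (pderiv (b ^ q) * a ^ p)) = smult (of_rat w) (a * pderiv (b ^ q)) * a ^ p"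
    by (simp add: mult_ac)
  also have "\<dots> = smult (of_rat t) (pderiv a * a ^ p) * b ^ q"
    unfolding b[symmetric] by (simp add: mult_ac)
  also have "\<dots> = smult (of_rat w) (a * (b ^ q * pderiv (a ^ p)))"
    unfolding a by (simp add: mult_ac)
  finally have "smult (of_rat w) (a * (pderiv (b ^ q) * a ^ p - b ^ q * pderiv (a ^ p))) = 0"
    by (simp add: algebra_simps smult_diff_right)
  then have "pderiv (b ^ q) * a ^ p = b ^ q * pderiv (a ^ p)"
    using assms by simp
  then show ?thesis
    using assms that by (elim proportional_of_wronskian_0) auto
qed

section \<open>Leading terms\<close>

definition lead :: "(int \<times> nat \<Rightarrow> 'a::field_char_0) \<Rightarrow> rat \<Rightarrow> 'a poly \<Rightarrow> bool" where
  "lead P d f \<longleftrightarrow> P \<in> filt d \<and> part d P = f \<and> f \<noteq> 0"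

lemma lead_Walg: "lead P d f \<Longrightarrow> P \<in> Walg"
  by (auto simp: lead_def filt_Walg)

lemma lead_nonzero: "lead P d f \<Longrightarrow> f \<noteq> 0" "lead P d f \<Longrightarrow> P \<noteq> 0"
  by (auto simp: lead_def)

lemma lead_attained:
  assumes "lead P d f"
  obtains e where "e \<in> wsupp P" "deg e = d"
proof -
  have "\<exists>e\<in>wsupp P. deg e = d"
  proof (rule ccontr)
    assume "\<not> ?thesis"
    then have "part d P = 0" unfolding part_def by (intro sum.neutral) auto
    then show False using assms by (simp add: lead_def)
  qed
  then show ?thesis using that by blast
qed

lemma lead_vdeg:
  assumes "lead P d f"
  shows "vdeg l \<rho> \<sigma> P = d"
proof -
  obtain e where "e \<in> wsupp P" "deg e = d" using lead_attained[OF assms] .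
  then show ?thesis
    using assms unfolding vdeg_def by (intro Max_eqI) (auto simp: lead_def filt_def Walg_finite)
qed

lemma lead_exists:
  assumes "P \<in> Walg" "P \<noteq> 0"
  shows "lead P (vdeg l \<rho> \<sigma> P) (part (vdeg l \<rho> \<sigma> P) P)"
proof -
  have fin: "finite (deg ` wsupp P)" using assms by (simp add: Walg_finite)
  have "wsupp P \<noteq> {}" using assms(2) by (auto simp: wsupp_def fun_eq_iff fun_apply)
  then have "vdeg l \<rho> \<sigma> P \<in> deg ` wsupp P"
    unfolding vdeg_def using fin by (intro Max_in) auto
  then obtain e where "e \<in> wsupp P" "deg e = vdeg l \<rho> \<sigma> P" by force
  then have "coeff (part (vdeg l \<rho> \<sigma> P) P) (snd e) \<noteq> 0"
    using assms by (simp add: coeff_part wsupp_def)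
  moreover have "P \<in> filt (vdeg l \<rho> \<sigma> P)"
    using assms fin by (auto simp: filt_def vdeg_def)
  ultimately show ?thesis by (auto simp: lead_def)
qed

lemma lead_unique:
  assumes "lead P d f" "lead P d' f'"
  shows "d = d'" "f = f'"
  using lead_vdeg[OF assms(1)] lead_vdeg[OF assms(2)] assms by (auto simp: lead_def)

lemma lead_le:
  assumes "lead P d f" "P \<in> filt d'"
  shows "d \<le> d'"
  using lead_attained[OF assms(1)] assms(2) by (auto simp: filt_def)

text \<open>Here \<open>d'\<close> is only an upper bound. For a commutator this gives a dichotomy:
  its degree is generic, or the Poisson bracket of the leading polynomials vanishes.\<close>

lemma lead_part:
  assumes "lead P d f" "P \<in> filt d'"
  shows "part d' P = (if d = d' then f else 0)"
proof (cases "part d' P = 0")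
  case True
  then show ?thesis using assms by (auto simp: lead_def)
next
  case False
  then have "lead P d' (part d' P)" using assms by (simp add: lead_def)
  then show ?thesis using lead_unique[OF assms(1)] by auto
qed

lemma lead_lterm:
  assumes "lead P d f"
  shows "lterm l \<rho> \<sigma> P = hom d f"
proof
  fix e
  show "lterm l \<rho> \<sigma> P e = hom d f e"
    using coeff_part[OF lead_Walg[OF assms], of e d] assms lead_vdeg[OF assms]
    by (auto simp: lterm_def hom_def lead_def)
qed

lemma part_lterm:
  assumes "P \<in> Walg"
  shows "part (vdeg l \<rho> \<sigma> P) (lterm l \<rho> \<sigma> P) = part (vdeg l \<rho> \<sigma> P) P"
  using Walg_finite[OF assms] unfolding part_def[of _ P]
  by (subst part_superset[of "wsupp P"])
    (auto simp: lterm_def wsupp_def split: if_splits intro!: sum.cong)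

lemma lterm_Walg: "P \<in> Walg \<Longrightarrow> lterm l \<rho> \<sigma> P \<in> Walg"
  unfolding Walg_def mem_Collect_eq
  by (erule finite_subset[rotated]) (auto simp: lterm_def wsupp_def)

text \<open>Equal leading terms do not mention degrees, but a monomial of degree \<open>d\<close> at
  which they do not vanish forces \<open>P\<close> to be nonzero and of degree
  \<open>d\<close>.\<close>

lemma lead_of_lterm_eq:
  assumes "lead Q d f" "P \<in> Walg" "lterm l \<rho> \<sigma> P = scal c (lterm l \<rho> \<sigma> Q)" "c \<noteq> 0"
  shows "lead P d (smult c f)"
proof -
  obtain e where e: "Q e \<noteq> 0" "deg e = d"
    using lead_attained[OF assms(1)] by (auto simp: wsupp_def)
  note vQ = lead_vdeg[OF assms(1)]
  have "lterm l \<rho> \<sigma> P e \<noteq> 0"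
    unfolding assms(3) using e assms(4) by (simp add: scal_def lterm_def vQ)
  then have P: "P \<noteq> 0" and vP: "vdeg l \<rho> \<sigma> P = d"
    using e(2) by (auto simp: lterm_def fun_apply split: if_splits)
  have "part d P = part d (lterm l \<rho> \<sigma> P)"
    using part_lterm[OF assms(2)] by (simp add: vP)
  also have "\<dots> = smult c (part d (lterm l \<rho> \<sigma> Q))"
    unfolding assms(3) by (rule part_scal[OF lterm_Walg[OF lead_Walg[OF assms(1)]]])
  also have "\<dots> = smult c f"
    using part_lterm[OF lead_Walg[OF assms(1)]] assms(1) by (simp add: vQ lead_def)
  finally show ?thesis
    using lead_exists[OF assms(2) P] by (simp add: vP)
qed

lemma lead_wmult: "lead P d f \<Longrightarrow> lead Q d' g \<Longrightarrow> lead (wmult l P Q) (d + d') (f * g)"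
  using filt_part_wmult[of P d Q d'] by (simp add: lead_def)

lemma lead_wone: "lead wone 0 1"
  by (simp add: lead_def wone_mono_at part_mono_at filt_mono_at wdeg_def monom_0 pCons_one)

lemma lead_wpow: "lead P d f \<Longrightarrow> lead (wpow l P n) (of_nat n * d) (f ^ n)"
proof (induction n)
  case (Suc n)
  then show ?case
    using lead_wmult[OF Suc.prems Suc.IH[OF Suc.prems]] by (simp add: ring_distribs)
qed (simp add: lead_wone)

text \<open>By the Leibniz rule the commutator is a sum of \<open>n + 1\<close> terms with the same
  leading polynomial \<open>b ^ n * g\<close>; in characteristic 0 they cannot cancel.\<close>

lemma lead_wcomm_wpow_Suc:
  assumes "A \<in> Walg" "lead B u b" "lead (wcomm l A B) z g"
  shows "lead (wcomm l A (wpow l B (Suc n))) (z + of_nat n * u) (smult (of_nat (Suc n)) (b ^ n * g))"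
proof (induction n)
  case 0
  then show ?case using assms lead_Walg[OF assms(2)] by simp
next
  case (Suc n)
  have BW: "B \<in> Walg" using lead_Walg[OF assms(2)] .
  let ?d = "z + of_nat (Suc n) * u"
  let ?P = "wmult l (wcomm l A B) (wpow l B (Suc n))"
  let ?Q = "wmult l B (wcomm l A (wpow l B (Suc n)))"
  have 1: "lead ?P ?d (g * b ^ Suc n)"
    by (rule lead_wmult[OF assms(3) lead_wpow[OF assms(2)]])
  have 2: "lead ?Q ?d (b * smult (of_nat (Suc n)) (b ^ n * g))"
    using lead_wmult[OF assms(2) Suc] by (simp add: algebra_simps)
  have "wcomm l A (wpow l B (Suc (Suc n))) = ?P + ?Q"
    unfolding wpow.simps(2)[of l B "Suc n"]
    using assms(1) BW l_pos by (intro wcomm_wmult_right) (simp_all del: wpow.simps)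
  moreover have "part ?d (?P + ?Q) = smult (of_nat (Suc (Suc n))) (b ^ Suc n * g)"
    using 1 2 part_add[OF lead_Walg[OF 1] lead_Walg[OF 2], of ?d]
    unfolding lead_def of_nat_Suc[of "Suc n"] smult_add_left
    by (simp add: mult_ac del: wpow.simps of_nat_Suc)
  ultimately show ?case
    using 1 2 assms(2,3) by (simp add: lead_def filt_add del: wpow.simps of_nat_Suc)
qed

text \<open>Degrees lie in (1/l) Z, which makes the descent terminate.\<close>

lemma lead_deg_Ints: "lead P d f \<Longrightarrow> d * of_nat l \<in> \<int>"
proof (elim lead_attained)
  fix e
  assume "deg e = d"
  then have "d * of_nat l = of_int (\<rho> * fst e + \<sigma> * int (snd e) * int l)"
    using l_pos by (auto simp: wdeg_def field_simps)
  then show ?thesis by (metis Ints_of_int)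
qed

section \<open>Descent\<close>

text \<open>Induction on the drop \<open>w + u - (\<rho> + \<sigma>) - z\<close> of the degree of \<open>[A, B]\<close> below its generic
  value, a nonnegative multiple of \<open>1/l\<close>. If it is positive, the leading terms of \<open>A\<close> and \<open>B\<close>
  Poisson commute, so some \<open>B ^ q\<close> and \<open>\<eta> A ^ p\<close> have the same leading term (after multiplying \<open>B\<close>
  by a power of \<open>A\<close> to make \<open>u\<close> nonnegative), and \<open>B ^ q - \<eta> A ^ p\<close> has a smaller drop.\<close>
lemma exists_pbracket_eq_power:
  assumes A: "lead A w a" and w: "w > 0"
    and "lead B u b" "lead (wcomm l A B) z g" "s \<ge> 1" "\<zeta> \<noteq> 0"
    and "g ^ s = smult \<zeta> (a ^ h)" "of_nat s * z = of_nat h * w"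
  shows "\<exists>D v d N \<mu>. lead D v d \<and> \<mu> \<noteq> 0 \<and> pbracket w v a d = smult \<mu> (a ^ N) \<and>
    w + v - of_int (\<rho> + \<sigma>) = of_nat N * w"
  using assms(3-)
proof (induction "nat \<lfloor>(w + u - of_int (\<rho> + \<sigma>) - z) * of_nat l\<rfloor>" arbitrary: B u b z g s \<zeta> h
    rule: less_induct)
  case less
  note B = less.prems(1) and AB = less.prems(2) and s = less.prems(3) and \<zeta> = less.prems(4)
    and gs = less.prems(5) and sz = less.prems(6)
  define t where "t = w + u - of_int (\<rho> + \<sigma>)"
  have AW: "A \<in> Walg" and BW: "B \<in> Walg"
    using A B by (auto dest: lead_Walg)
  have anz: "a \<noteq> 0" and bnz: "b \<noteq> 0" and gnz: "g \<noteq> 0"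
    using A B AB by (auto dest: lead_nonzero)
  have filt: "wcomm l A B \<in> filt t" and part: "part t (wcomm l A B) = pbracket w u a b"
    using filt_part_wcomm[of A w B u] A B by (auto simp: lead_def t_def)
  have zt: "z \<le> t" using lead_le[OF AB filt] .
  have ag: "pbracket w z a g = 0"
    using pbracket_eq_0_of_power[OF gs sz s gnz] .
  show ?case
  proof (cases "z = t")
    case True
    obtain n where n: "s = Suc n" using s by (cases s) auto
    \<comment> \<open>Here \<open>pbracket w u a b\<close> is \<open>g\<close>, and \<open>g\<close>
      Poisson commutes with \<open>a\<close>, so the bracket of \<open>a\<close> with
      \<open>b * g ^ (s - 1)\<close> is \<open>g ^ s\<close>.\<close>
    let ?D = "wmult l B (wpow l (wcomm l A B) n)"
    have "lead ?D (u + of_nat n * z) (b * g ^ n)"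
      by (intro lead_wmult B lead_wpow AB)
    moreover have "pbracket w u a b = g"
      using lead_part[OF AB filt] part True by simp
    then have "pbracket w (u + of_nat n * z) a (b * g ^ n) = smult \<zeta> (a ^ h)"
      unfolding pbracket_mult_right using ag gs by (simp add: pbracket_power_eq_0 n)
    moreover have "w + (u + of_nat n * z) - of_int (\<rho> + \<sigma>) = of_nat h * w"
      using True unfolding sz[symmetric] n t_def by (simp add: algebra_simps)
    ultimately show ?thesis using \<zeta> by blast
  next
    case False
    then have ab: "pbracket w u a b = 0"
      using lead_part[OF AB filt] part by simp
    obtain r :: nat where r: "u + of_nat r * w \<ge> 0"
    proof -
      obtain r where "- u / w < of_nat r" using reals_Archimedean2 by blast
      then show ?thesis using that[of r] w by (simp add: field_simps)
    qed
    \<comment> \<open>Multiplying by \<open>A ^ r\<close> raises \<open>u\<close> and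
      \<open>z\<close> equally, so the drop stays the same; as \<open>u1\<close> is nonnegative,
      \<open>p\<close> below can be a natural number.\<close>
    define B1 u1 b1 where "B1 = wmult l B (wpow l A r)" and "u1 = u + of_nat r * w" and "b1 = b * a ^ r"
    define z1 g1 where "z1 = z + of_nat r * w" and "g1 = g * a ^ r"
    have B1: "lead B1 u1 b1"
      unfolding B1_def u1_def b1_def by (intro lead_wmult B lead_wpow A)
    have "wcomm l A B1 = wmult l (wcomm l A B) (wpow l A r)"
      using AW BW l_pos by (simp add: B1_def wcomm_wmult_right wcomm_self_wpow)
    then have AB1: "lead (wcomm l A B1) z1 g1"
      unfolding z1_def g1_def using lead_wmult[OF AB lead_wpow[OF A, of r]] by simp
    have ab1: "pbracket w u1 a b1 = 0"
      unfolding u1_def b1_def pbracket_mult_right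
      using ab by (simp add: pbracket_power_eq_0 pbracket_self)
    have "0 \<le> u1 / w" using r w by (simp add: u1_def)
    then obtain p q :: nat where q: "q \<ge> 1" and "of_nat q * (u1 / w) = of_nat p"
      by (rule nonneg_rat_eq_ratio)
    then have pq: "of_nat q * u1 = of_nat p * w" using w by (simp add: field_simps)
    obtain \<eta> where \<eta>: "\<eta> \<noteq> 0" "b1 ^ q = smult \<eta> (a ^ p)"
      using power_proportional_of_pbracket_0[OF ab1 anz lead_nonzero(1)[OF B1] _ pq] w by auto
    obtain n where n: "q = Suc n" using q by (cases q) auto
    \<comment> \<open>The subtracted term commutes with \<open>A\<close>, so \<open>B2\<close> has
      the same commutator with \<open>A\<close> as \<open>B1 ^ q\<close>, while its degree is
      smaller.\<close>
    define B2 where "B2 = wpow l B1 q - scal \<eta> (wpow l A p)"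
    define z2 g2 where "z2 = z1 + of_nat n * u1" and "g2 = smult (of_nat q) (b1 ^ n * g1)"
    have "wcomm l A B2 = wcomm l A (wpow l B1 q)"
    proof -
      have "scal \<eta> 0 = (0 :: int \<times> nat \<Rightarrow> 'a)" by (auto simp: scal_def fun_apply)
      then show ?thesis
        using AW lead_Walg[OF B1] l_pos
        by (simp add: B2_def wcomm_diff_scal_right wcomm_self_wpow)
    qed
    then have AB2: "lead (wcomm l A B2) z2 g2"
      using lead_wcomm_wpow_Suc[OF AW B1 AB1, of n] by (simp add: n z2_def g2_def del: wpow.simps)
    then have "B2 \<noteq> 0" using lead_nonzero(2)[OF AB2] by auto
    moreover have W2: "B2 \<in> Walg" using AW lead_Walg[OF B1] by (simp add: B2_def)
    ultimately obtain u2 b2 where B2: "lead B2 u2 b2" using lead_exists by blast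
    have "wpow l B1 q \<in> filt (of_nat q * u1)" "part (of_nat q * u1) (wpow l B1 q) = smult \<eta> (a ^ p)"
      using lead_wpow[OF B1, of q] by (auto simp: lead_def \<eta>(2))
    moreover have "wpow l A p \<in> filt (of_nat q * u1)" "part (of_nat q * u1) (wpow l A p) = a ^ p"
      using lead_wpow[OF A, of p] by (auto simp: lead_def pq)
    ultimately have B2f: "B2 \<in> filt (of_nat q * u1)" and "part (of_nat q * u1) B2 = 0"
      using AW lead_Walg[OF B1] unfolding B2_def
      by (auto intro!: filt_diff filt_scal simp: part_diff part_scal)
    then have "u2 < of_nat q * u1"
      using lead_le[OF B2 B2f] lead_part[OF B2 B2f] lead_nonzero(1)[OF B2]
      by (auto simp: less_le split: if_splits)
    \<comment> \<open>Passing from \<open>B1\<close> to \<open>B1 ^ q\<close> adds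
      \<open>n * u1\<close> to both degrees, so the whole decrease comes from
      \<open>u2 < q * u1\<close>.\<close>
    then have drop: "w + u2 - of_int (\<rho> + \<sigma>) - z2 < t - z"
      unfolding z2_def n t_def u1_def z1_def by (simp add: algebra_simps)
    have "z2 \<le> w + u2 - of_int (\<rho> + \<sigma>)"
      using lead_le[OF AB2] filt_part_wcomm[of A w B2 u2] A B2 by (auto simp: lead_def)
    then have pos: "0 \<le> (w + u2 - of_int (\<rho> + \<sigma>) - z2) * of_nat l" by simp
    have "(t - z) * of_nat l = w * of_nat l + u * of_nat l - z * of_nat l - of_int ((\<rho> + \<sigma>) * int l)"
      by (simp add: t_def algebra_simps)
    also have "\<dots> \<in> \<int>"
      by (intro Ints_diff Ints_add Ints_of_int lead_deg_Ints[OF A] lead_deg_Ints[OF B] lead_deg_Ints[OF AB])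
    \<comment> \<open>Since this value is an integer, every smaller number has a smaller
      floor.\<close>
    finally obtain k where k: "(t - z) * of_nat l = of_int k" by (elim Ints_cases)
    have "(w + u2 - of_int (\<rho> + \<sigma>) - z2) * of_nat l < of_int k"
      unfolding k[symmetric] using drop l_pos by (intro mult_strict_right_mono) auto
    then have "nat \<lfloor>(w + u2 - of_int (\<rho> + \<sigma>) - z2) * of_nat l\<rfloor> <
        nat \<lfloor>(w + u - of_int (\<rho> + \<sigma>) - z) * of_nat l\<rfloor>"
      using pos k unfolding t_def by (simp add: floor_less_iff nat_less_eq_zless)
    moreover have "s * q \<ge> 1" using s q by simp
    \<comment> \<open>With the exponent \<open>s * q\<close>, the factors of \<open>g2\<close>
      become powers of \<open>b1 ^ q\<close> and \<open>g1 ^ s\<close>, hence multiples of powers of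
      \<open>a\<close>; \<open>\<zeta>2\<close> collects the constants.\<close>
    moreover define \<zeta>2 where "\<zeta>2 = of_nat q ^ (s * q) * \<eta> ^ (n * s) * \<zeta> ^ q"
    have "\<zeta>2 \<noteq> 0" using \<zeta> \<eta> q by (simp add: \<zeta>2_def)
    moreover have "g2 ^ (s * q) = smult \<zeta>2 (a ^ (p * (n * s) + (h + r * s) * q))"
    proof -
      have "g1 ^ s = smult \<zeta> (a ^ (h + r * s))"
        by (simp add: g1_def power_mult_distrib gs power_add power_mult)
      then have "g1 ^ (s * q) = smult (\<zeta> ^ q) (a ^ ((h + r * s) * q))"
        by (simp add: power_mult smult_power)
      moreover have "(b1 ^ n) ^ (s * q) = (b1 ^ q) ^ (n * s)"
        by (simp add: mult_ac flip: power_mult)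
      then have "(b1 ^ n) ^ (s * q) = smult (\<eta> ^ (n * s)) (a ^ (p * (n * s)))"
        by (simp only: \<eta>(2) smult_power power_mult)
      ultimately show ?thesis
        by (simp add: g2_def \<zeta>2_def smult_power power_mult_distrib power_add mult_ac)
    qed
    moreover have "of_nat (s * q) * z2 = of_nat (p * (n * s) + (h + r * s) * q) * w"
    proof -
      have "of_nat (s * q) * z2 = of_nat q * (of_nat s * z + of_nat s * of_nat r * w) +
          of_nat s * of_nat n * (of_nat q * u1)"
        by (simp add: z2_def z1_def algebra_simps)
      also have "\<dots> = of_nat (p * (n * s) + (h + r * s) * q) * w"
        unfolding sz pq by (simp add: algebra_simps)
      finally show ?thesis .
    qed
    ultimately show ?thesis using less.hyps[OF _ B2 AB2] by blast
  qed
qed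

section \<open>From leading polynomials back to the bracket of the theorem\<close>

lemma hom_smult: "hom d (smult c f) = scal c (hom d f)"
  by (auto simp: hom_def scal_def)

text \<open>A nonzero Poisson bracket means that the commutator has its generic degree, so
  \<open>wbracket\<close> takes its nonzero branch.\<close>

lemma wbracket_eq_lterm:
  assumes "lead P d f" "lead Q d' g" "pbracket d d' f g \<noteq> 0"
  shows "wbracket l \<rho> \<sigma> P Q = hom (d + d' - of_int (\<rho> + \<sigma>)) (pbracket d d' f g)"
proof -
  have R: "lead (wcomm l P Q) (d + d' - of_int (\<rho> + \<sigma>)) (pbracket d d' f g)"
    using filt_part_wcomm[of P d Q d'] assms by (auto simp: lead_def)
  have "wcomm l P Q \<noteq> (\<lambda>_. 0)"
    using lead_nonzero(2)[OF R] by (simp add: zero_fun_def)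
  then show ?thesis
    using lead_vdeg[OF R] lead_vdeg[OF assms(1)] lead_vdeg[OF assms(2)] lead_lterm[OF R]
    by (simp add: wbracket_def Let_def)
qed

text \<open>\<open>A\<close> shares its leading term with \<open>C ^ n\<close>, so the element found
  by the descent for \<open>A\<close> also serves for \<open>C ^ n\<close>.\<close>

lemma exists_wbracket_eq_wpow:
  assumes CW: "C \<in> Walg" and C0: "C \<noteq> 0" and vC: "vdeg l \<rho> \<sigma> C > 0"
    and n: "n \<ge> 1" and AW: "A \<in> Walg" and BW: "B \<in> Walg"
    and A: "lterm l \<rho> \<sigma> A = lterm l \<rho> \<sigma> (wpow l C n)"
    and lam: "lam \<noteq> 0"
    and AB: "lterm l \<rho> \<sigma> (wcomm l A B) = scal lam (lterm l \<rho> \<sigma> (wpow l C h))"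
  shows "\<exists>D\<in>Walg. \<exists>\<mu>. \<exists>j. \<mu> \<noteq> 0 \<and> j \<ge> 1 \<and>
    wbracket l \<rho> \<sigma> D (wpow l C n) = scal \<mu> (lterm l \<rho> \<sigma> (wpow l C (n + j)))"
proof -
  define w c where "w = vdeg l \<rho> \<sigma> C" and "c = part w C"
  have C: "lead C w c" using lead_exists[OF CW C0] by (simp add: w_def c_def)
  have w: "w > 0" using vC by (simp add: w_def)
  define w' a where "w' = of_nat n * w" and "a = c ^ n"
  have Cn: "lead (wpow l C n) w' a" unfolding w'_def a_def by (rule lead_wpow[OF C])
  have lA: "lead A w' a"
    using lead_of_lterm_eq[OF Cn AW, of 1] A by (simp add: scal_def)
  have lAB: "lead (wcomm l A B) (of_nat h * w) (smult lam (c ^ h))"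
    using lead_of_lterm_eq[OF lead_wpow[OF C] Walg_wcomm[OF AW BW] AB lam] .
  then have "B \<noteq> 0" using lead_nonzero(2) by fastforce
  then obtain u b where lB: "lead B u b" using lead_exists[OF BW] by blast
  \<comment> \<open>The power \<open>n\<close> turns \<open>c ^ h\<close> into \<open>a ^ h\<close>,
    so the descent can start with \<open>s = n\<close>.\<close>
  have "smult lam (c ^ h) ^ n = smult (lam ^ n) (a ^ h)"
    by (simp add: smult_power a_def mult.commute flip: power_mult)
  moreover have "of_nat n * (of_nat h * w) = of_nat h * w'"
    by (simp add: w'_def)
  moreover have "w' > 0" "lam ^ n \<noteq> 0" using n w lam by (simp_all add: w'_def)
  ultimately obtain D v d N \<mu> where D: "lead D v d" and \<mu>: "\<mu> \<noteq> 0"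
    and br: "pbracket w' v a d = smult \<mu> (a ^ N)" and deg: "w' + v - of_int (\<rho> + \<sigma>) = of_nat N * w'"
    using exists_pbracket_eq_power[OF lA _ lB lAB n] by blast
  \<comment> \<open>The factor \<open>C ^ (n * 2)\<close> commutes with \<open>C ^ n\<close> and
    raises the exponent \<open>n * N\<close> to \<open>n + n * (N + 1)\<close>, so that the excess
    over \<open>n\<close> is positive even if \<open>N = 0\<close>.\<close>
  define D' v' d' where "D' = wmult l D (wpow l C (n * 2))" and "v' = v + of_nat 2 * w'" and "d' = d * a ^ 2"
  have "of_nat (n * 2) * w = of_nat 2 * w'" by (simp add: w'_def)
  then have "lead (wpow l C (n * 2)) (of_nat 2 * w') (a ^ 2)"
    using lead_wpow[OF C, of "n * 2"] by (simp only: a_def power_mult)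
  then have D': "lead D' v' d'"
    unfolding D'_def v'_def d'_def by (rule lead_wmult[OF D])
  have br': "pbracket v' w' d' a = smult (- \<mu>) (c ^ (n + n * (N + 1)))"
  proof -
    have "pbracket w' v' a d' = smult \<mu> (a ^ N) * a ^ 2"
      unfolding v'_def d'_def pbracket_mult_right br
        pbracket_power_eq_0[OF pbracket_self] by simp
    also have "\<dots> = smult \<mu> (c ^ (n * N + n * 2))"
      by (simp add: a_def power_mult power_add)
    also have "n * N + n * 2 = n + n * (N + 1)" by simp
    finally show ?thesis by (simp add: pbracket_swap[of v'])
  qed
  have "v' + w' - of_int (\<rho> + \<sigma>) = of_nat N * w' + of_nat 2 * w'"
    using deg by (simp add: v'_def)
  also have "\<dots> = of_nat (n + n * (N + 1)) * w"
    by (simp add: w'_def algebra_simps)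
  finally have deg': "v' + w' - of_int (\<rho> + \<sigma>) = of_nat (n + n * (N + 1)) * w" .
  have "wbracket l \<rho> \<sigma> D' (wpow l C n) = hom (v' + w' - of_int (\<rho> + \<sigma>)) (pbracket v' w' d' a)"
    using \<mu> lead_nonzero(1)[OF C] by (intro wbracket_eq_lterm D' Cn) (simp add: br')
  also have "\<dots> = scal (- \<mu>) (lterm l \<rho> \<sigma> (wpow l C (n + n * (N + 1))))"
    unfolding deg' br' hom_smult lead_lterm[OF lead_wpow[OF C]] ..
  finally show ?thesis
    using \<mu> n lead_Walg[OF D'] by (intro bexI[of _ D'] exI[of _ "- \<mu>"] exI[of _ "n * (N + 1)"]) auto
qed

end

theorem theorem3p1:
  fixes l :: nat and \<rho> \<sigma> :: int and C :: "int \<times> nat \<Rightarrow> 'a::field_char_0"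
  assumes l: "l \<ge> 1"
    and V: "coprime \<rho> \<sigma>" "\<rho> + \<sigma> > 0"
    and sig: "\<sigma> \<le> 0"
    and CW: "C \<in> Walg" and C0: "C \<noteq> (\<lambda>_. 0)"
    and vC: "vdeg l \<rho> \<sigma> C > 0"
    and nopow: "\<forall>D\<in>Walg. \<forall>\<zeta>::'a. \<forall>h::nat. \<zeta> \<noteq> 0 \<and> h > 1 \<longrightarrow>
                  lterm l \<rho> \<sigma> C \<noteq> scal \<zeta> (lterm l \<rho> \<sigma> (wpow l D h))"
    and ex: "\<exists>n m :: nat. \<exists>A\<in>Walg. \<exists>B\<in>Walg. n \<ge> 1 \<and> m \<ge> 1 \<and>
               lterm l \<rho> \<sigma> A = lterm l \<rho> \<sigma> (wpow l C n) \<and>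
               lterm l \<rho> \<sigma> B = lterm l \<rho> \<sigma> (wpow l C m) \<and>
               gcd n m \<notin> {n, m} \<and>
               (\<exists>h::nat. \<exists>lam::'a. lam \<noteq> 0 \<and>
                  lterm l \<rho> \<sigma> (wcomm l A B) = scal lam (lterm l \<rho> \<sigma> (wpow l C h)))"
  shows "\<exists>D\<in>Walg. \<exists>\<mu>::'a. \<exists>k j0 :: nat. \<mu> \<noteq> 0 \<and> k \<ge> 1 \<and> j0 \<ge> 1 \<and>
           wbracket l \<rho> \<sigma> D (wpow l C k) = scal \<mu> (lterm l \<rho> \<sigma> (wpow l C (k + j0)))"
proof -
  \<comment> \<open>\<rho> > 0 follows from \<sigma> \<le> 0 and \<rho> + \<sigma> > 0.\<close>
  interpret weyl_grading l \<rho> \<sigma>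
    using l V sig by unfold_locales auto
  obtain n A B h lam where n: "n \<ge> 1" and A: "A \<in> Walg" "lterm l \<rho> \<sigma> A = lterm l \<rho> \<sigma> (wpow l C n)"
    and B: "B \<in> Walg" and lam: "lam \<noteq> (0::'a)"
    and AB: "lterm l \<rho> \<sigma> (wcomm l A B) = scal lam (lterm l \<rho> \<sigma> (wpow l C h))"
    using ex by blast
  have "C \<noteq> 0" using C0 by (simp add: zero_fun_def)
  from exists_wbracket_eq_wpow[OF CW this vC n A(1) B A(2) lam AB] n
  show ?thesis by blast
qed

end
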